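(* Let $R$ be an integral domain. The assignment $\Psi(\nu)=\mathcal{C}_{\nu}$ is a bijection from the set of ideal valuations on $R$ to the set of standard, countable descending chains of finite type, stable semistar operations on $R$, with inverse given by $\Psi^{-1}(\mathcal{C})=\nu_{\mathcal{C}}$.
   Context: $R$ is an integral domain with quotient field $K$. $\mathcal{S}(R)$ is the set of all ideals of $R$ (including $0$ and $R$), $f\mathcal{S}(R)$ the set of finitely generated ideals of $R$, $\overline{F}(R)$ the set of nonzero $R$-submodules of $K$, and $\overline{\mathbb{N}}=\{0,1,2,\ldots\}\cup\{\infty\}$. For $R$-submodules $I,J$ of $K$, $(I:_K J)=\{x\in K\mid xJ\subseteq I\}$. Ideal valuation: a function $\nu:\mathcal{S}(R)\to\overline{\mathbb{N}}$ such that (IV1) $\nu(0)=0$ and $\nu(R)=\infty$; (IV2) $\min\{\nu(I),\nu(J)\}\le\nu(IJ)$ for all $I,J\in\mathcal{S}(R)$; (IV3) $\nu(I)=\sup\{\nu(J)\mid J\subseteq I,\ J\in f\mathcal{S}(R)\}$ for all $I\in\mathcal{S}(R)$. Semistar operation: a map $*:\overline{F}(R)\to\overline{F}(R)$, $I\mapsto I^*$ (also written $I_*$), such that for all $I,J\in\overline{F}(R)$ and $x\in K\setminus\{0\}$: $I\subseteq I^*$; $I\subseteq J$ implies $I^*\subseteq J^*$; $(xI)^*=xI^*$; $(I^* )^*=I^*$. It is stable if $(I\cap J)^*=I^*\cap J^*$ for all $I,J\in\overline{F}(R)$. It is of finite type if $I^*=\bigcup\{J^*\mid J\subseteq I,\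 J \text{ a nonzero finitely generated } R\text{-submodule of } K\}$ for all $I\in\overline{F}(R)$. Semistar operations are ordered by $*\ge *'$ iff $I^{*}\supseteq I^{*'}$ for all $I\in\overline{F}(R)$. The operation $e$ is $I_e=K$ for all $I\in\overline{F}(R)$. A standard, countable descending chain of finite type, stable semistar operations on $R$ is a family (sequence) $\mathcal{C}=\{*_n\}_{n=0}^{\infty}$ of finite type, stable semistar operations with $*_n\ge *_{n+1}$ for all $n\ge 0$ and $*_0=e$. Given an ideal valuation $\nu$ and an integer $n\ge 0$, let $G(\nu,n)=\{J\in\mathcal{S}(R)\mid\nu(J)\ge n\}$ and let $\nu_n$ be the map on $\overline{F}(R)$ given by $I_{\nu_n}=\bigcup_{J\in G(\nu,n)}(I:_K J)$. Set $\mathcal{C}_{\nu}=\{\nu_n\}_{n=0}^{\infty}$. Given such a chain $\mathcal{C}=\{*_n\}_{n=0}^\infty$, define $\nu_{\mathcal{C}}:\mathcal{S}(R)\to\overline{\mathbb{N}}$ by $\nu_{\mathcal{C}}(0)=0$ and $\nu_{\mathcal{C}}(I)=\sup\{k\ge 0\mid I_{*_k}=R_{*_k}\}$ for $I\neq 0$. *)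

theory Defs
  imports "HOL-Computational_Algebra.Polynomial_Factorial" "HOL-Library.Extended_Nat" "HOL-Library.FuncSet"
begin

text \<open>
  The domain \<open>R\<close> is a type \<open>'a :: idom\<close> and its quotient field \<open>K\<close> is \<open>'a fract\<close>. Maps defined on
  the ideals of \<open>R\<close>, or on the nonzero \<open>R\<close>-submodules of \<open>K\<close>, are total functions on sets that take
  the value \<open>undefined\<close> elsewhere (\<open>\<rightarrow>\<^sub>E\<close>), so that such a map is determined by its values on its domain.
\<close>

abbreviation frac_scale :: "'a::idom \<Rightarrow> 'a fract \<Rightarrow> 'a fract"
  where "frac_scale r x \<equiv> to_fract r * x"

lemma module_ring: "module ((*) :: 'a::idom \<Rightarrow> 'a \<Rightarrow> 'a)"
  by unfold_locales (simp_all add: algebra_simps)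

lemma module_frac: "module (frac_scale :: 'a::idom \<Rightarrow> 'a fract \<Rightarrow> 'a fract)"
  by unfold_locales (simp_all add: algebra_simps)

definition ideals :: "'a::idom set set"
  where "ideals = {I. module.subspace (*) I}"

definition fg_ideals :: "'a::idom set set"
  where "fg_ideals = {I. \<exists>B. finite B \<and> I = module.span (*) B}"

definition ideal_mult :: "'a::idom set \<Rightarrow> 'a set \<Rightarrow> 'a set"
  where "ideal_mult I J = module.span (*) {a * b | a b. a \<in> I \<and> b \<in> J}"

definition ideal_valuations :: "('a::idom set \<Rightarrow> enat) set"
  where "ideal_valuations = {\<nu> \<in> ideals \<rightarrow>\<^sub>E UNIV.
    \<nu> {0} = 0 \<and> \<nu> UNIV = \<infinity> \<and>
    (\<forall>I\<in>ideals. \<forall>J\<in>ideals. min (\<nu> I) (\<nu> J) \<le> \<nu> (ideal_mult I J)) \<and>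
    (\<forall>I\<in>ideals. \<nu> I = Sup {\<nu> J | J. J \<in> fg_ideals \<and> J \<subseteq> I})}"

definition nz_submodules :: "'a::idom fract set set"
  where "nz_submodules = {I. module.subspace frac_scale I \<and> I \<noteq> {0}}"

definition fg_nz_submodules :: "'a::idom fract set set"
  where "fg_nz_submodules = {I \<in> nz_submodules. \<exists>B. finite B \<and> I = module.span frac_scale B}"

definition semistar_operation :: "('a::idom fract set \<Rightarrow> 'a fract set) \<Rightarrow> bool"
  where "semistar_operation s \<longleftrightarrow>
    s \<in> nz_submodules \<rightarrow>\<^sub>E nz_submodules \<and>
    (\<forall>I\<in>nz_submodules. I \<subseteq> s I) \<and>
    (\<forall>I\<in>nz_submodules. \<forall>J\<in>nz_submodules. I \<subseteq> J \<longrightarrow> s I \<subseteq> s J) \<and>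
    (\<forall>I\<in>nz_submodules. \<forall>x. x \<noteq> 0 \<longrightarrow> s ((*) x ` I) = (*) x ` s I) \<and>
    (\<forall>I\<in>nz_submodules. s (s I) = s I)"

definition stable :: "('a::idom fract set \<Rightarrow> 'a fract set) \<Rightarrow> bool"
  where "stable s \<longleftrightarrow> (\<forall>I\<in>nz_submodules. \<forall>J\<in>nz_submodules. s (I \<inter> J) = s I \<inter> s J)"

definition finite_type :: "('a::idom fract set \<Rightarrow> 'a fract set) \<Rightarrow> bool"
  where "finite_type s \<longleftrightarrow>
    (\<forall>I\<in>nz_submodules. s I = \<Union> {s J | J. J \<in> fg_nz_submodules \<and> J \<subseteq> I})"

definition semistar_le ::
    "('a::idom fract set \<Rightarrow> 'a fract set) \<Rightarrow> ('a fract set \<Rightarrow> 'a fract set) \<Rightarrow> bool"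
  where "semistar_le s t \<longleftrightarrow> (\<forall>I\<in>nz_submodules. s I \<subseteq> t I)"

definition semistar_e :: "'a::idom fract set \<Rightarrow> 'a fract set"
  where "semistar_e = (\<lambda>I\<in>nz_submodules. UNIV)"

definition standard_chains :: "(nat \<Rightarrow> 'a::idom fract set \<Rightarrow> 'a fract set) set"
  where "standard_chains = {C.
    (\<forall>n. semistar_operation (C n) \<and> stable (C n) \<and> finite_type (C n)) \<and>
    (\<forall>n. semistar_le (C (Suc n)) (C n)) \<and>
    C 0 = semistar_e}"

definition colon :: "'a::idom fract set \<Rightarrow> 'a fract set \<Rightarrow> 'a fract set"
  where "colon I J = {x. (*) x ` J \<subseteq> I}"

definition level_ideals :: "('a::idom set \<Rightarrow> enat) \<Rightarrow> nat \<Rightarrow> 'a set set"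
  where "level_ideals \<nu> n = {J \<in> ideals. enat n \<le> \<nu> J}"

definition chain_of_valuation ::
    "('a::idom set \<Rightarrow> enat) \<Rightarrow> nat \<Rightarrow> 'a fract set \<Rightarrow> 'a fract set"
  where "chain_of_valuation \<nu> n = (\<lambda>I\<in>nz_submodules. \<Union>J\<in>level_ideals \<nu> n. colon I (to_fract ` J))"

definition valuation_of_chain ::
    "(nat \<Rightarrow> 'a::idom fract set \<Rightarrow> 'a fract set) \<Rightarrow> 'a set \<Rightarrow> enat"
  where "valuation_of_chain C = (\<lambda>I\<in>ideals.
    if I = {0} then 0 else Sup {enat k | k. C k (to_fract ` I) = C k (range to_fract)})"

end

theory Submission
  imports Defs
begin

text \<open>
  A finite type, stable semistar operation \<open>*\<close> is recovered from the filter of ideals \<open>J\<close> with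
  \<open>1 \<in> J\<^sup>*\<close>: by stability, \<open>x \<in> I\<^sup>*\<close> holds iff the ideal of all \<open>r\<close> with \<open>r x \<in> I\<close> lies in the
  filter. Conversely, every filter of ideals that is closed under products and generated by finitely
  generated ideals arises in this way. An ideal valuation amounts to a descending sequence of such
  filters, namely its level sets, the one at level \<open>0\<close> containing the zero ideal and hence
  giving the operation \<open>e\<close>.
\<close>

interpretation ring_mod: module "(*) :: 'a::idom \<Rightarrow> 'a \<Rightarrow> 'a"
  by (rule module_ring)

interpretation frac_mod: module "frac_scale :: 'a::idom \<Rightarrow> 'a fract \<Rightarrow> 'a fract"
  by (rule module_frac)

\<comment> \<open>Together with \<open>mult.assoc\<close> and \<open>to_fract_mult\<close>, these would make the simplifier loop.\<close>
declare ring_mod.scale_scale [simp del] frac_mod.scale_scale [simp del]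

subsection \<open>Ideals and submodules of the quotient field\<close>

lemma ideals_iff:
  "I \<in> ideals \<longleftrightarrow> 0 \<in> I \<and> (\<forall>x\<in>I. \<forall>y\<in>I. x + y \<in> I) \<and> (\<forall>r. \<forall>x\<in>I. r * x \<in> I)"
  by (auto simp: ideals_def ring_mod.subspace_def)

lemma nz_submodules_iff:
  "I \<in> nz_submodules \<longleftrightarrow>
    0 \<in> I \<and> (\<forall>x\<in>I. \<forall>y\<in>I. x + y \<in> I) \<and> (\<forall>r. \<forall>x\<in>I. to_fract r * x \<in> I) \<and> (\<exists>x\<in>I. x \<noteq> 0)"
  by (auto simp: nz_submodules_def frac_mod.subspace_def)

lemma zero_ideal: "{0} \<in> ideals"
  and UNIV_ideal: "UNIV \<in> ideals"
  and fg_ideals_subset: "fg_ideals \<subseteq> ideals"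
  and ideal_mult_ideal: "ideal_mult I J \<in> ideals"
  by (auto simp: ideals_iff fg_ideals_def ideal_mult_def ring_mod.span_zero
      intro: ring_mod.span_add ring_mod.span_scale)

lemma zero_fg_ideal: "{0} \<in> fg_ideals"
  unfolding fg_ideals_def by (auto intro!: exI[of _ "{}"])

lemma ideal_Int: "I \<in> ideals \<Longrightarrow> J \<in> ideals \<Longrightarrow> I \<inter> J \<in> ideals"
  by (auto simp: ideals_iff)

lemma ideal_mult_subset:
  assumes "K \<in> ideals" "\<And>a b. a \<in> I \<Longrightarrow> b \<in> J \<Longrightarrow> a * b \<in> K"
  shows "ideal_mult I J \<subseteq> K"
  unfolding ideal_mult_def
  by (rule ring_mod.span_minimal) (use assms in \<open>auto simp: ideals_def\<close>)

lemma mult_mem_ideal_mult: "a \<in> I \<Longrightarrow> b \<in> J \<Longrightarrow> a * b \<in> ideal_mult I J"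
  unfolding ideal_mult_def by (rule ring_mod.span_base) auto

section \<open>Nonzero submodules of the quotient field and the traces they leave on the
  ring\<close>

lemma fract_cases:
  fixes x :: "'a::idom fract"
  obtains a b where "b \<noteq> 0" "x = to_fract a / to_fract b"
  by (cases x) (auto simp: Fract_conv_to_fract)

lemma nz_submodule_meets_ring:
  assumes "I \<in> nz_submodules"
  obtains a where "a \<noteq> 0" "to_fract a \<in> I"
proof -
  obtain x where x: "x \<in> I" "x \<noteq> 0" using assms by (auto simp: nz_submodules_iff)
  obtain a b where ab: "b \<noteq> 0" "x = to_fract a / to_fract b" by (rule fract_cases)
  have "to_fract b * x = to_fract a" using ab by simp
  moreover have "to_fract b * x \<in> I" using assms x by (auto simp: nz_submodules_iff)
  moreover have "a \<noteq> 0" using ab x by auto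
  ultimately show ?thesis using that by simp
qed

text \<open>Only nonzeroness needs an argument: both submodules contain nonzero ring elements, and
  since there are no zero divisors the product of two such elements is a nonzero common
  element.\<close>

lemma nz_submodule_Int:
  assumes I: "I \<in> nz_submodules" and J: "J \<in> nz_submodules"
  shows "I \<inter> J \<in> nz_submodules"
proof -
  obtain a b where a: "a \<noteq> 0" "to_fract a \<in> I" and b: "b \<noteq> 0" "to_fract b \<in> J"
    using nz_submodule_meets_ring[OF I] nz_submodule_meets_ring[OF J] by metis
  have "to_fract (a * b) \<in> I \<inter> J"
    using I J a b by (auto simp: nz_submodules_iff) (metis mult.commute)
  moreover have "to_fract (a * b) \<noteq> 0" using a b by simp
  ultimately have "\<exists>x\<in>I \<inter> J. x \<noteq> 0" by blast
  then show ?thesis using I J by (simp add: nz_submodules_iff)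
qed

lemma nz_submodule_scale:
  assumes "I \<in> nz_submodules" "c \<noteq> 0"
  shows "(*) c ` I \<in> nz_submodules"
  using assms unfolding nz_submodules_iff
  by (auto simp: image_iff mult.left_commute simp flip: distrib_left)

lemma nz_submodule_of_ideal:
  assumes "I \<in> ideals" "I \<noteq> {0}"
  shows "to_fract ` I \<in> nz_submodules"
proof -
  obtain a where "a \<in> I" "a \<noteq> 0" using assms by (auto simp: ideals_iff)
  then show ?thesis
    using assms unfolding nz_submodules_iff ideals_iff
    by (auto simp: image_iff simp flip: to_fract_add to_fract_mult)
qed

lemma range_nz_submodule: "range to_fract \<in> nz_submodules"
  by (intro nz_submodule_of_ideal UNIV_ideal) (metis UNIV_I singletonD zero_neq_one)

lemma range_subset_nz_submodule:
  assumes "I \<in> nz_submodules" "1 \<in> I"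
  shows "range to_fract \<subseteq> I"
  using assms by (force simp: nz_submodules_iff)

section \<open>Images of finitely generated ideals and submodules\<close>

lemma to_fract_span: "to_fract ` ring_mod.span B = frac_mod.span (to_fract ` B)"
proof -
  interpret module_hom "(*) :: 'a \<Rightarrow> _" frac_scale to_fract
    by unfold_locales simp_all
  show ?thesis by (rule span_image[symmetric])
qed

lemma scale_span: "(*) c ` frac_mod.span B = frac_mod.span ((*) c ` B)"
proof -
  interpret module_hom frac_scale frac_scale "(*) c"
    by unfold_locales (simp_all add: algebra_simps)
  show ?thesis by (rule span_image[symmetric])
qed

text \<open>Finite type speaks of submodules of the quotient field, (IV3) of ideals. This passes
  from the former to the latter: generators inside the image of \<open>I\<close> lift to finitely
  many ring elements.\<close>

lemma fg_nz_submodule_imp_fg_ideal: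
  assumes J: "J \<in> fg_nz_submodules" and sub: "J \<subseteq> to_fract ` I"
  obtains J' where "J' \<in> fg_ideals" "J' \<noteq> {0}" "J = to_fract ` J'"
proof -
  obtain B where B: "finite B" "J = frac_mod.span B" and nz: "J \<noteq> {0}"
    using J by (auto simp: fg_nz_submodules_def nz_submodules_def)
  have "B \<subseteq> to_fract ` I" using B sub frac_mod.span_superset by blast
  then obtain B' where B': "finite B'" "B = to_fract ` B'"
    using B(1) by (metis finite_subset_image)
  have "J = to_fract ` ring_mod.span B'" using B B' by (simp add: to_fract_span)
  moreover from this nz have "ring_mod.span B' \<noteq> {0}" by auto
  ultimately show ?thesis using that B' by (auto simp: fg_ideals_def)
qed

text \<open>This is the conductor (I :_R x). Every later membership question about a closure is
  reduced to this single ideal.\<close>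

definition denominators :: "'a::idom fract set \<Rightarrow> 'a fract \<Rightarrow> 'a set"
  where "denominators I x = {r. to_fract r * x \<in> I}"

lemma denominators_ideal:
  assumes "I \<in> nz_submodules"
  shows "denominators I x \<in> ideals"
  using assms
  by (auto simp: denominators_def ideals_iff nz_submodules_iff distrib_right mult.assoc)

lemma mem_colon_iff: "x \<in> colon I (to_fract ` J) \<longleftrightarrow> J \<subseteq> denominators I x"
  by (auto simp: colon_def denominators_def mult.commute image_subset_iff)

lemma mem_scale_iff:
  fixes c :: "'a::field"
  assumes "c \<noteq> 0"
  shows "x \<in> (*) c ` I \<longleftrightarrow> x / c \<in> I"
proof
  assume "x / c \<in> I"
  then show "x \<in> (*) c ` I" using assms by (intro image_eqI[of _ _ "x / c"]) simp_all
qed (use assms in auto)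

lemma denominators_scale: "c \<noteq> 0 \<Longrightarrow> denominators ((*) c ` I) x = denominators I (x / c)"
  by (simp add: denominators_def mem_scale_iff)

subsection \<open>The semistar operation of a filter of ideals\<close>

text \<open>Such a family is a localizing system (Gabriel filter) with a base of finitely generated
  ideals. The zero ideal may be a member, so that level 0 of a valuation is covered as well.\<close>

locale finite_type_filter =
  fixes F :: "'a::idom set set"
  assumes subset_ideals: "F \<subseteq> ideals"
    and UNIV_mem: "UNIV \<in> F"
    and mult_mem: "I \<in> F \<Longrightarrow> J \<in> F \<Longrightarrow> ideal_mult I J \<in> F"
    and upward: "I \<in> F \<Longrightarrow> J \<in> ideals \<Longrightarrow> I \<subseteq> J \<Longrightarrow> J \<in> F"
    and fg_below: "I \<in> F \<Longrightarrow> \<exists>J\<in>F. J \<in> fg_ideals \<and> J \<subseteq> I"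
begin

lemma Int_mem:
  assumes "I \<in> F" "J \<in> F"
  shows "I \<inter> J \<in> F"
proof (rule upward[OF mult_mem[OF assms]])
  show *: "I \<inter> J \<in> ideals" using assms subset_ideals by (auto intro: ideal_Int)
  show "ideal_mult I J \<subseteq> I \<inter> J"
    by (rule ideal_mult_subset[OF *])
      (use assms subset_ideals in \<open>force simp: ideals_iff subset_iff mult.commute\<close>)
qed

lemma INT_mem:
  assumes "finite B" "\<And>b. b \<in> B \<Longrightarrow> D b \<in> F"
  shows "(\<Inter>b\<in>B. D b) \<in> F"
  using assms by (induction B rule: finite_induct) (auto intro: Int_mem UNIV_mem)

definition star :: "'a fract set \<Rightarrow> 'a fract set"
  where "star = (\<lambda>I\<in>nz_submodules. \<Union>J\<in>F. colon I (to_fract ` J))"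

text \<open>The conductor is the largest ideal \<open>J\<close> with \<open>x\<close> in the colon
  of \<open>I\<close> by \<open>J\<close>, so upward closure collapses the union defining
  \<open>star\<close> to one membership test.\<close>

lemma mem_star_iff:
  assumes "I \<in> nz_submodules"
  shows "x \<in> star I \<longleftrightarrow> denominators I x \<in> F"
  using assms upward[OF _ denominators_ideal[OF assms]]
  by (auto simp: star_def mem_colon_iff)

lemma subset_star:
  assumes "I \<in> nz_submodules"
  shows "I \<subseteq> star I"
proof
  fix x assume "x \<in> I"
  then have "denominators I x = UNIV"
    using assms by (auto simp: denominators_def nz_submodules_iff)
  then show "x \<in> star I" using assms UNIV_mem by (simp add: mem_star_iff)
qed

lemma star_mono:
  assumes "I \<in> nz_submodules" "J \<in> nz_submodules" "I \<subseteq> J"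
  shows "star I \<subseteq> star J"
proof
  fix x assume "x \<in> star I"
  then show "x \<in> star J"
    using assms upward[OF _ denominators_ideal[OF assms(2)], of "denominators I x" x]
    by (auto simp: mem_star_iff denominators_def)
qed

lemma star_nz_submodule:
  assumes I: "I \<in> nz_submodules"
  shows "star I \<in> nz_submodules"
  unfolding nz_submodules_iff
proof (intro conjI ballI allI)
  show "0 \<in> star I" "\<exists>x\<in>star I. x \<noteq> 0"
    using subset_star[OF I] I by (auto simp: nz_submodules_iff)
next
  fix x y assume "x \<in> star I" "y \<in> star I"
  then have "denominators I x \<inter> denominators I y \<in> F" using I by (simp add: mem_star_iff Int_mem)
  moreover have "denominators I x \<inter> denominators I y \<subseteq> denominators I (x + y)"
    using I by (auto simp: denominators_def nz_submodules_iff distrib_left)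
  ultimately show "x + y \<in> star I"
    using upward[OF _ denominators_ideal[OF I]] by (simp add: mem_star_iff I)
next
  fix r x assume "x \<in> star I"
  moreover have "denominators I x \<subseteq> denominators I (to_fract r * x)"
    using I by (auto simp: denominators_def nz_submodules_iff mult.left_commute[of _ "to_fract r"])
  ultimately show "to_fract r * x \<in> star I"
    using upward[OF _ denominators_ideal[OF I]] by (simp add: mem_star_iff I)
qed

lemma star_scale:
  assumes I: "I \<in> nz_submodules" and c: "c \<noteq> 0"
  shows "star ((*) c ` I) = (*) c ` star I"
proof -
  have "x \<in> star ((*) c ` I) \<longleftrightarrow> x \<in> (*) c ` star I" for x
    using I c by (simp add: mem_star_iff nz_submodule_scale denominators_scale mem_scale_iff)
  then show ?thesis by blast
qed

text \<open>Idempotence rests on \<open>fg_below\<close>. A finitely generated \<open>J\<close> in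
  the filter carries \<open>x\<close> into \<open>star I\<close>; each generator b has the conductor
  of b x in the filter. The finite intersection \<open>H\<close> of these is again a member, and the
  product of \<open>J\<close> and \<open>H\<close> carries \<open>x\<close> into
  \<open>I\<close>.\<close>

lemma star_star:
  assumes I: "I \<in> nz_submodules"
  shows "star (star I) = star I"
proof
  show "star I \<subseteq> star (star I)" by (intro subset_star star_nz_submodule I)
  show "star (star I) \<subseteq> star I"
  proof
    fix x assume "x \<in> star (star I)"
    then have "denominators (star I) x \<in> F" using star_nz_submodule[OF I] mem_star_iff by blast
    then obtain J where J: "J \<in> F" "J \<in> fg_ideals" "J \<subseteq> denominators (star I) x"
      using fg_below by blast
    obtain B where B: "finite B" "J = ring_mod.span B" using J by (auto simp: fg_ideals_def)
    define H where "H = (\<Inter>b\<in>B. denominators I (to_fract b * x))"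
    have "denominators I (to_fract b * x) \<in> F" if "b \<in> B" for b
    proof -
      have "b \<in> denominators (star I) x" using that B J(3) ring_mod.span_base by blast
      then have "to_fract b * x \<in> star I" by (simp add: denominators_def)
      then show ?thesis using I by (simp only: mem_star_iff)
    qed
    then have H: "H \<in> F" unfolding H_def using B by (intro INT_mem)
    \<comment> \<open>The elements multiplying \<open>H\<close> into the conductor form an ideal, so
      it suffices to test the generators in \<open>B\<close>.\<close>
    have "J \<subseteq> {r. \<forall>h\<in>H. r * h \<in> denominators I x}"
      unfolding B
    proof (rule ring_mod.span_minimal)
      show "B \<subseteq> {r. \<forall>h\<in>H. r * h \<in> denominators I x}"
        by (auto simp: H_def denominators_def ac_simps)
      show "ring_mod.subspace {r. \<forall>h\<in>H. r * h \<in> denominators I x}"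
        using denominators_ideal[OF I, of x]
        by (auto simp: ring_mod.subspace_def ideals_iff distrib_right mult.assoc)
    qed
    then have "ideal_mult J H \<subseteq> denominators I x"
      by (intro ideal_mult_subset denominators_ideal[OF I]) auto
    then show "x \<in> star I"
      using upward[OF mult_mem[OF J(1) H] denominators_ideal[OF I]] I by (simp add: mem_star_iff)
  qed
qed

lemma semistar_operation_star: "semistar_operation star"
  unfolding semistar_operation_def
  using subset_star star_mono star_scale star_star star_nz_submodule
  by (auto simp: PiE_def extensional_def star_def)

text \<open>Forming conductors commutes with intersections, and the filter is closed under
  them.\<close>

lemma stable_star: "stable star"
proof -
  have "star (I \<inter> J) = star I \<inter> star J" if IJ: "I \<in> nz_submodules" "J \<in> nz_submodules" for I J
  proof
    show "star (I \<inter> J) \<subseteq> star I \<inter> star J" using IJ by (simp add: star_mono nz_submodule_Int)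
    show "star I \<inter> star J \<subseteq> star (I \<inter> J)"
    proof
      fix x assume "x \<in> star I \<inter> star J"
      then have "denominators I x \<inter> denominators J x \<in> F" using IJ by (simp add: mem_star_iff Int_mem)
      moreover have "denominators I x \<inter> denominators J x = denominators (I \<inter> J) x"
        by (auto simp: denominators_def)
      ultimately show "x \<in> star (I \<inter> J)" using IJ by (simp add: mem_star_iff nz_submodule_Int)
    qed
  qed
  then show ?thesis by (simp add: stable_def)
qed

text \<open>If a finitely generated \<open>J\<close> in the filter satisfies x J contained in
  \<open>I\<close>, then any finitely generated submodule of \<open>I\<close> that contains x J
  already has \<open>x\<close> in its closure.\<close>

lemma finite_type_star: "finite_type star"
  unfolding finite_type_def
proof (intro ballI equalityI)
  fix I :: "'a fract set" assume I: "I \<in> nz_submodules"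
  show "\<Union> {star J |J. J \<in> fg_nz_submodules \<and> J \<subseteq> I} \<subseteq> star I"
    using star_mono I by (auto simp: fg_nz_submodules_def)
  show "star I \<subseteq> \<Union> {star J |J. J \<in> fg_nz_submodules \<and> J \<subseteq> I}"
  proof
    fix x assume "x \<in> star I"
    then have "denominators I x \<in> F" using I by (simp add: mem_star_iff)
    then obtain J where J: "J \<in> F" "J \<in> fg_ideals" "J \<subseteq> denominators I x"
      using fg_below by blast
    obtain B where B: "finite B" "J = ring_mod.span B" using J by (auto simp: fg_ideals_def)
    obtain m where m: "m \<in> I" "m \<noteq> 0" using I by (auto simp: nz_submodules_iff)
    \<comment> \<open>Adjoining \<open>m\<close> keeps the submodule nonzero when \<open>x J = 0\<close>.\<close>
    define M where "M = frac_mod.span (insert m ((*) x ` to_fract ` B))"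
    have xJ: "(*) x ` to_fract ` J \<subseteq> M"
      unfolding B(2) to_fract_span scale_span M_def by (rule frac_mod.span_mono) auto
    have "(*) x ` to_fract ` B \<subseteq> I"
      using J(3) ring_mod.span_superset[of B] unfolding B(2)
      by (auto simp: denominators_def mult.commute)
    then have MI: "M \<subseteq> I"
      unfolding M_def using m I by (intro frac_mod.span_minimal) (auto simp: nz_submodules_def)
    have "m \<in> M" by (simp add: M_def frac_mod.span_base)
    then have nz: "M \<in> nz_submodules"
      using m by (auto simp: M_def nz_submodules_def)
    then have "M \<in> fg_nz_submodules"
      using B(1) unfolding fg_nz_submodules_def M_def
      by (auto intro!: exI[of _ "insert m ((*) x ` to_fract ` B)"])
    moreover have "x \<in> star M"
      using xJ J(1) nz by (auto simp: star_def colon_def intro!: bexI[of _ J])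
    ultimately show "x \<in> \<Union> {star J |J. J \<in> fg_nz_submodules \<and> J \<subseteq> I}" using MI by blast
  qed
qed

text \<open>The filter can be read off from its operation on nonzero ideals: the conductor of 1 in
  \<open>I\<close> is \<open>I\<close> itself, and once 1 lies in the closure of \<open>I\<close>,
  so does the whole ring, whence idempotence gives equality.\<close>

lemma star_ideal_eq_star_ring_iff:
  assumes I: "I \<in> ideals" "I \<noteq> {0}"
  shows "star (to_fract ` I) = star (range to_fract) \<longleftrightarrow> I \<in> F"
proof -
  have nz: "to_fract ` I \<in> nz_submodules" using I by (rule nz_submodule_of_ideal)
  have "denominators (to_fract ` I) 1 = I" by (auto simp: denominators_def)
  then have *: "1 \<in> star (to_fract ` I) \<longleftrightarrow> I \<in> F" using nz by (simp add: mem_star_iff)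
  have "1 \<in> star (range to_fract)"
    using subset_star[OF range_nz_submodule] by (metis rangeI subsetD to_fract_1)
  moreover have "star (to_fract ` I) = star (range to_fract)" if "1 \<in> star (to_fract ` I)"
  proof
    show "star (to_fract ` I) \<subseteq> star (range to_fract)"
      by (intro star_mono nz range_nz_submodule) auto
    have "star (range to_fract) \<subseteq> star (star (to_fract ` I))"
      by (intro star_mono range_nz_submodule star_nz_submodule nz range_subset_nz_submodule that)
    then show "star (range to_fract) \<subseteq> star (to_fract ` I)" by (simp add: star_star nz)
  qed
  ultimately show ?thesis using * by auto
qed

end

subsection \<open>From ideal valuations to chains\<close>

lemma enat_le_Sup_iff:
  assumes "A \<noteq> {}"
  shows "enat n \<le> Sup A \<longleftrightarrow> (\<exists>a\<in>A. enat n \<le> a)"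
proof
  assume L: "enat n \<le> Sup A"
  show "\<exists>a\<in>A. enat n \<le> a"
  proof (cases n)
    case 0
    then show ?thesis using assms by (auto simp flip: zero_enat_def)
  next
    \<comment> \<open>By discreteness a positive bound is a strict inequality
      \<open>enat m < Sup A\<close>, which a member of \<open>A\<close> must witness. For the bound
      0 any member serves, and here nonemptiness is essential.\<close>
    case (Suc m)
    then have "enat m < Sup A" using L by (metis Suc_ile_eq)
    then obtain a where "a \<in> A" "enat m < a" by (auto simp: less_Sup_iff)
    then show ?thesis using Suc by (auto simp: Suc_ile_eq)
  qed
qed (auto intro: Sup_upper2)

lemma enat_leI:
  fixes x y :: enat
  assumes "\<And>n. enat n \<le> x \<Longrightarrow> enat n \<le> y"
  shows "x \<le> y"
  using assms by (cases x; cases y) (auto, metis Suc_n_not_le_n)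

lemma enat_eqI:
  fixes x y :: enat
  assumes "\<And>n. enat n \<le> x \<longleftrightarrow> enat n \<le> y"
  shows "x = y"
  using assms by (auto intro: antisym enat_leI)

text \<open>Monotonicity is not an axiom but follows from (IV3): a larger ideal contains more
  finitely generated ideals, so the supremum grows.\<close>

lemma ideal_valuation_mono:
  assumes "\<nu> \<in> ideal_valuations" "I \<in> ideals" "J \<in> ideals" "I \<subseteq> J"
  shows "\<nu> I \<le> \<nu> J"
proof -
  have "\<nu> I = Sup {\<nu> H |H. H \<in> fg_ideals \<and> H \<subseteq> I}" "\<nu> J = Sup {\<nu> H |H. H \<in> fg_ideals \<and> H \<subseteq> J}"
    using assms by (auto simp: ideal_valuations_def)
  then show ?thesis using assms by (auto intro!: Sup_subset_mono)
qed

text \<open>The axioms match one by one: (IV1) puts the ring into each level, (IV2) gives products,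
  monotonicity gives upward closure, and (IV3) gives finitely generated members below.\<close>

lemma finite_type_filter_level_ideals:
  assumes nu: "\<nu> \<in> ideal_valuations"
  shows "finite_type_filter (level_ideals \<nu> n)"
proof
  show "level_ideals \<nu> n \<subseteq> ideals" by (auto simp: level_ideals_def)
  show "UNIV \<in> level_ideals \<nu> n"
    using nu by (auto simp: level_ideals_def ideal_valuations_def UNIV_ideal)
next
  fix I J assume IJ: "I \<in> level_ideals \<nu> n" "J \<in> level_ideals \<nu> n"
  have "enat n \<le> min (\<nu> I) (\<nu> J)" using IJ by (simp add: level_ideals_def)
  also have "\<dots> \<le> \<nu> (ideal_mult I J)"
    using nu IJ by (auto simp: ideal_valuations_def level_ideals_def)
  finally show "ideal_mult I J \<in> level_ideals \<nu> n"
    by (simp add: level_ideals_def ideal_mult_ideal)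
next
  fix I J assume *: "I \<in> level_ideals \<nu> n" "J \<in> ideals" "I \<subseteq> J"
  then have "enat n \<le> \<nu> I" by (simp add: level_ideals_def)
  also have "\<dots> \<le> \<nu> J" using * by (intro ideal_valuation_mono[OF nu]) (auto simp: level_ideals_def)
  finally show "J \<in> level_ideals \<nu> n" using * by (simp add: level_ideals_def)
next
  fix I assume I: "I \<in> level_ideals \<nu> n"
  then have "\<nu> I = Sup {\<nu> H |H. H \<in> fg_ideals \<and> H \<subseteq> I}"
    using nu by (auto simp: ideal_valuations_def level_ideals_def)
  then have "enat n \<le> Sup {\<nu> H |H. H \<in> fg_ideals \<and> H \<subseteq> I}" using I by (simp add: level_ideals_def)
  moreover have "{\<nu> H |H. H \<in> fg_ideals \<and> H \<subseteq> I} \<noteq> {}"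
    using I zero_fg_ideal by (auto simp: level_ideals_def ideals_iff intro!: exI[of _ "{0}"])
  ultimately obtain H where "H \<in> fg_ideals" "H \<subseteq> I" "enat n \<le> \<nu> H"
    by (auto simp: enat_le_Sup_iff)
  then show "\<exists>J\<in>level_ideals \<nu> n. J \<in> fg_ideals \<and> J \<subseteq> I"
    using fg_ideals_subset by (auto simp: level_ideals_def)
qed

lemma chain_of_valuation_eq_star:
  "\<nu> \<in> ideal_valuations \<Longrightarrow> chain_of_valuation \<nu> n = finite_type_filter.star (level_ideals \<nu> n)"
  by (simp add: finite_type_filter.star_def finite_type_filter_level_ideals chain_of_valuation_def)

lemma chain_of_valuation_0: "chain_of_valuation \<nu> 0 = semistar_e"
proof -
  have "x \<in> (\<Union>J\<in>level_ideals \<nu> 0. colon I (to_fract ` J))" if "I \<in> nz_submodules" for I x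
    using that zero_ideal
    by (auto simp: level_ideals_def colon_def nz_submodules_iff simp flip: zero_enat_def
        intro!: bexI[of _ "{0}"])
  then show ?thesis
    unfolding chain_of_valuation_def semistar_e_def by (intro restrict_ext) blast
qed

lemma chain_of_valuation_standard:
  assumes nu: "\<nu> \<in> ideal_valuations"
  shows "chain_of_valuation \<nu> \<in> standard_chains"
proof -
  have "semistar_operation (chain_of_valuation \<nu> n) \<and> stable (chain_of_valuation \<nu> n)
      \<and> finite_type (chain_of_valuation \<nu> n)" for n
  proof -
    interpret finite_type_filter "level_ideals \<nu> n" by (rule finite_type_filter_level_ideals[OF nu])
    show ?thesis using semistar_operation_star stable_star finite_type_star
      by (simp add: chain_of_valuation_eq_star nu)
  qed
  moreover have "level_ideals \<nu> (Suc n) \<subseteq> level_ideals \<nu> n" for n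
    by (auto simp: level_ideals_def Suc_ile_eq less_imp_le)
  then have "semistar_le (chain_of_valuation \<nu> (Suc n)) (chain_of_valuation \<nu> n)" for n
    unfolding semistar_le_def chain_of_valuation_def by (simp add: UN_mono)
  ultimately show ?thesis unfolding standard_chains_def by (simp only: mem_Collect_eq simp_thms
    chain_of_valuation_0)
qed

lemma valuation_of_chain_of_valuation:
  assumes nu: "\<nu> \<in> ideal_valuations"
  shows "valuation_of_chain (chain_of_valuation \<nu>) = \<nu>"
proof
  fix I :: "'a set"
  consider "I \<notin> ideals" | "I = {0}" | "I \<in> ideals" "I \<noteq> {0}" by blast
  then show "valuation_of_chain (chain_of_valuation \<nu>) I = \<nu> I"
  proof cases
    case 1
    then show ?thesis using nu
      by (auto simp: valuation_of_chain_def ideal_valuations_def PiE_def extensional_def)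
  next
    case 2
    then show ?thesis using nu by (simp add: valuation_of_chain_def ideal_valuations_def zero_ideal)
  next
    case 3
    \<comment> \<open>The levels at which \<open>I\<close> and the ring have equal closures are
      exactly those whose filter contains \<open>I\<close>.\<close>
    have eq: "chain_of_valuation \<nu> k (to_fract ` I) = chain_of_valuation \<nu> k (range to_fract)
        \<longleftrightarrow> enat k \<le> \<nu> I" for k
      using finite_type_filter.star_ideal_eq_star_ring_iff[OF finite_type_filter_level_ideals[OF nu] 3] 3
      by (simp add: chain_of_valuation_eq_star nu level_ideals_def)
    \<comment> \<open>Comparing finite lower bounds treats finite and infinite values of the
      valuation alike.\<close>
    have "Sup {enat k |k. enat k \<le> \<nu> I} = \<nu> I"
    proof (rule enat_eqI)
      fix n
      have "{enat k |k. enat k \<le> \<nu> I} \<noteq> {}"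
        by (auto simp flip: zero_enat_def intro!: exI[of _ 0])
      then show "enat n \<le> Sup {enat k |k. enat k \<le> \<nu> I} \<longleftrightarrow> enat n \<le> \<nu> I"
        by (auto simp: enat_le_Sup_iff intro: order_trans)
    qed
    then show ?thesis using 3 by (simp add: valuation_of_chain_def eq)
  qed
qed

subsection \<open>From chains to ideal valuations\<close>

lemma semistar_operationD:
  assumes "semistar_operation s"
  shows semistar_closed: "I \<in> nz_submodules \<Longrightarrow> s I \<in> nz_submodules"
    and semistar_extensional: "I \<notin> nz_submodules \<Longrightarrow> s I = undefined"
    and semistar_subset: "I \<in> nz_submodules \<Longrightarrow> I \<subseteq> s I"
    and semistar_mono: "I \<in> nz_submodules \<Longrightarrow> J \<in> nz_submodules \<Longrightarrow> I \<subseteq> J \<Longrightarrow> s I \<subseteq> s J"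
    and semistar_scale: "I \<in> nz_submodules \<Longrightarrow> x \<noteq> 0 \<Longrightarrow> s ((*) x ` I) = (*) x ` s I"
    and semistar_idem: "I \<in> nz_submodules \<Longrightarrow> s (s I) = s I"
  using assms by (auto simp: semistar_operation_def PiE_def extensional_def Pi_iff)

lemma semistar_hull_subset:
  assumes "semistar_operation s" "I \<in> nz_submodules" "J \<in> nz_submodules" "I \<subseteq> s J"
  shows "s I \<subseteq> s J"
  using semistar_mono[OF assms(1,2) semistar_closed[OF assms(1,3)] assms(4)]
    semistar_idem[OF assms(1,3)] by simp

lemma semistar_one_mem: "semistar_operation s \<Longrightarrow> 1 \<in> s (range to_fract)"
  using semistar_subset[OF _ range_nz_submodule] by (metis rangeI subsetD to_fract_1)

text \<open>If 1 lies in the closure of \<open>I\<close>, the closure contains the ring, and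
  idempotence closes the gap. The equation defining the valuation of a chain thus becomes a
  membership test for 1.\<close>

lemma semistar_eq_ring_iff:
  assumes s: "semistar_operation s" and I: "I \<in> nz_submodules" "I \<subseteq> range to_fract"
  shows "s I = s (range to_fract) \<longleftrightarrow> 1 \<in> s I"
proof
  assume "s I = s (range to_fract)"
  then show "1 \<in> s I" using semistar_one_mem[OF s] by simp
next
  assume "1 \<in> s I"
  then show "s I = s (range to_fract)"
    by (intro equalityI semistar_mono[OF s] semistar_hull_subset[OF s] I range_nz_submodule
        range_subset_nz_submodule semistar_closed[OF s])
qed

text \<open>From x J contained in \<open>I\<close>, scaling and monotonicity give x times
  \<open>s J\<close> inside \<open>s I\<close>; now use that 1 is in \<open>s J\<close>. The case
  \<open>x = 0\<close> is separate because the scaling axiom demands a nonzero factor.\<close>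

lemma semistar_mem_of_colon:
  assumes s: "semistar_operation s" and I: "I \<in> nz_submodules" and J: "J \<in> nz_submodules"
    and one: "1 \<in> s J" and x: "x \<in> colon I J"
  shows "x \<in> s I"
proof (cases "x = 0")
  case True
  then show ?thesis using semistar_closed[OF s I] by (simp add: nz_submodules_iff)
next
  case False
  have "s ((*) x ` J) \<subseteq> s I"
    using x by (intro semistar_mono[OF s] nz_submodule_scale J I False) (simp add: colon_def)
  moreover have "x \<in> (*) x ` s J" using one by force
  ultimately show ?thesis using semistar_scale[OF s J False] by blast
qed

section \<open>The ideal valuation of a fixed chain\<close>

context
  fixes C :: "nat \<Rightarrow> 'a::idom fract set \<Rightarrow> 'a fract set"
  assumes C: "C \<in> standard_chains"
begin

lemma chain_semistar: "semistar_operation (C n)"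
  and chain_stable: "stable (C n)"
  and chain_finite_type: "finite_type (C n)"
  and chain_0: "C 0 = semistar_e"
  using C by (auto simp: standard_chains_def)

lemma chain_antimono:
  assumes "I \<in> nz_submodules" "m \<le> n"
  shows "C n I \<subseteq> C m I"
  using \<open>m \<le> n\<close>
proof (induction rule: dec_induct)
  case (step n)
  have "C (Suc n) I \<subseteq> C n I" using C assms by (auto simp: standard_chains_def semistar_le_def)
  then show ?case using step by blast
qed simp

text \<open>Since the chain descends, the set of k in the supremum is downward closed, so a bound n
  on the supremum is decided at level n itself. The disjunct \<open>n = 0\<close> is needed for the
  zero ideal, whose value is set to 0.\<close>

lemma le_valuation_of_chain_iff:
  assumes "I \<in> ideals"
  shows "enat n \<le> valuation_of_chain C I \<longleftrightarrow> n = 0 \<or> I \<noteq> {0} \<and> 1 \<in> C n (to_fract ` I)"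
proof (cases "I = {0}")
  case True
  then show ?thesis by (auto simp: valuation_of_chain_def zero_ideal zero_enat_def)
next
  case False
  have nz: "to_fract ` I \<in> nz_submodules" using assms False by (rule nz_submodule_of_ideal)
  then have "valuation_of_chain C I = Sup {enat k |k. 1 \<in> C k (to_fract ` I)}"
    using assms False
    by (simp add: valuation_of_chain_def semistar_eq_ring_iff[OF chain_semistar] image_mono)
  moreover have zero: "1 \<in> C 0 (to_fract ` I)" using nz by (simp add: chain_0 semistar_e_def)
  then have "{enat k |k. 1 \<in> C k (to_fract ` I)} \<noteq> {}" by blast
  ultimately have "enat n \<le> valuation_of_chain C I \<longleftrightarrow> (\<exists>k\<ge>n. 1 \<in> C k (to_fract ` I))"
    by (auto simp: enat_le_Sup_iff)
  also have "\<dots> \<longleftrightarrow> 1 \<in> C n (to_fract ` I)" using chain_antimono[OF nz] by blast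
  finally show ?thesis using zero False by auto
qed

lemma valuation_of_chain_mono:
  assumes "I \<in> ideals" "J \<in> ideals" "I \<subseteq> J"
  shows "valuation_of_chain C I \<le> valuation_of_chain C J"
proof (rule enat_leI)
  fix n assume n: "enat n \<le> valuation_of_chain C I"
  show "enat n \<le> valuation_of_chain C J"
  proof (cases "n = 0")
    case False
    then have I: "I \<noteq> {0}" "1 \<in> C n (to_fract ` I)"
      using n assms by (auto simp: le_valuation_of_chain_iff)
    then have J: "J \<noteq> {0}" using assms by (auto simp: ideals_iff)
    have "C n (to_fract ` I) \<subseteq> C n (to_fract ` J)"
      using assms I J by (intro semistar_mono[OF chain_semistar] nz_submodule_of_ideal image_mono)
    then show ?thesis using I J assms by (auto simp: le_valuation_of_chain_iff)
  qed (simp add: zero_enat_def[symmetric])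
qed

text \<open>This is the core of (IV2). For a in \<open>I\<close>, a J lies in the product and 1 lies
  in the closure of \<open>J\<close>, so a lies in the closure of the product. That closure
  therefore contains the closure of \<open>I\<close>, and hence 1.\<close>

lemma one_mem_chain_ideal_mult:
  assumes I: "I \<in> ideals" "I \<noteq> {0}" "1 \<in> C n (to_fract ` I)"
    and J: "J \<in> ideals" "J \<noteq> {0}" "1 \<in> C n (to_fract ` J)"
  shows "ideal_mult I J \<noteq> {0} \<and> 1 \<in> C n (to_fract ` ideal_mult I J)"
proof -
  obtain a b where "a \<in> I" "a \<noteq> 0" "b \<in> J" "b \<noteq> 0" using I J by (auto simp: ideals_iff)
  then have nz: "ideal_mult I J \<noteq> {0}"
    using mult_mem_ideal_mult by (metis mult_eq_0_iff singletonD)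
  have IJ: "to_fract ` ideal_mult I J \<in> nz_submodules"
    by (intro nz_submodule_of_ideal ideal_mult_ideal nz)
  have "to_fract a \<in> C n (to_fract ` ideal_mult I J)" if "a \<in> I" for a
  proof (rule semistar_mem_of_colon[OF chain_semistar IJ _ J(3)])
    show "to_fract ` J \<in> nz_submodules" using J by (intro nz_submodule_of_ideal)
    show "to_fract a \<in> colon (to_fract ` ideal_mult I J) (to_fract ` J)"
      using mult_mem_ideal_mult[OF that] by (auto simp: colon_def simp flip: to_fract_mult)
  qed
  then have "C n (to_fract ` I) \<subseteq> C n (to_fract ` ideal_mult I J)"
    using I nz_submodule_of_ideal[OF I(1,2)]
    by (intro semistar_hull_subset[OF chain_semistar] IJ image_subsetI)
  then show ?thesis using nz I by blast
qed

text \<open>This is the nontrivial half of (IV3): finite type places 1 in the closure of a finitely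
  generated submodule of \<open>I\<close>, which is the image of an ideal. At level 0 the zero ideal
  suffices.\<close>

lemma valuation_of_chain_fg:
  assumes I: "I \<in> ideals" and n: "enat n \<le> valuation_of_chain C I"
  shows "\<exists>J\<in>fg_ideals. J \<subseteq> I \<and> enat n \<le> valuation_of_chain C J"
proof (cases "n = 0")
  case True
  then show ?thesis using zero_fg_ideal I
    by (auto simp: ideals_iff simp flip: zero_enat_def intro!: bexI[of _ "{0}"])
next
  case False
  then have I': "I \<noteq> {0}" "1 \<in> C n (to_fract ` I)" using n I by (auto simp: le_valuation_of_chain_iff)
  then have "C n (to_fract ` I) = \<Union> {C n J |J. J \<in> fg_nz_submodules \<and> J \<subseteq> to_fract ` I}"
    using chain_finite_type nz_submodule_of_ideal[OF I] by (auto simp: finite_type_def)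
  then obtain J where J: "J \<in> fg_nz_submodules" "J \<subseteq> to_fract ` I" "1 \<in> C n J" using I' by blast
  obtain J' where J': "J' \<in> fg_ideals" "J' \<noteq> {0}" "J = to_fract ` J'"
    using J(1,2) by (rule fg_nz_submodule_imp_fg_ideal)
  have "J' \<subseteq> I" using J J' by (auto simp: image_iff subset_iff)
  moreover have "enat n \<le> valuation_of_chain C J'"
    using J J' fg_ideals_subset by (auto simp: le_valuation_of_chain_iff)
  ultimately show ?thesis using J' by blast
qed

lemma valuation_of_chain_ideal_valuation: "valuation_of_chain C \<in> ideal_valuations"
  unfolding ideal_valuations_def
proof (intro CollectI conjI ballI)
  show "valuation_of_chain C \<in> ideals \<rightarrow>\<^sub>E UNIV" by (simp add: valuation_of_chain_def)
  show "valuation_of_chain C {0} = 0" by (simp add: valuation_of_chain_def zero_ideal)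
  have "(UNIV :: 'a set) \<noteq> {0}" by (metis UNIV_I singletonD zero_neq_one)
  then have "enat n \<le> valuation_of_chain C UNIV" for n
    by (simp add: le_valuation_of_chain_iff UNIV_ideal semistar_one_mem chain_semistar)
  then show "valuation_of_chain C UNIV = \<infinity>" by (intro enat_eqI) simp
next
  fix I J :: "'a set" assume IJ: "I \<in> ideals" "J \<in> ideals"
  have le: "enat n \<le> valuation_of_chain C (ideal_mult I J)"
    if "enat n \<le> valuation_of_chain C I" "enat n \<le> valuation_of_chain C J" for n
    using that IJ one_mem_chain_ideal_mult[OF IJ(1) _ _ IJ(2), of n]
    by (auto simp: le_valuation_of_chain_iff ideal_mult_ideal)
  show "min (valuation_of_chain C I) (valuation_of_chain C J) \<le> valuation_of_chain C (ideal_mult I J)"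
    by (rule enat_leI) (simp add: le)
next
  fix I :: "'a set" assume I: "I \<in> ideals"
  let ?A = "{valuation_of_chain C J |J. J \<in> fg_ideals \<and> J \<subseteq> I}"
  have ne: "?A \<noteq> {}" using I zero_fg_ideal by (auto simp: ideals_iff intro!: exI[of _ "{0}"])
  show "valuation_of_chain C I = Sup ?A"
  proof (rule enat_eqI)
    fix n
    have "enat n \<le> valuation_of_chain C I"
      if "J \<in> fg_ideals" "J \<subseteq> I" "enat n \<le> valuation_of_chain C J" for J
      using that valuation_of_chain_mono[OF _ I that(2)] fg_ideals_subset by (meson order_trans subsetD)
    then show "enat n \<le> valuation_of_chain C I \<longleftrightarrow> enat n \<le> Sup ?A"
      unfolding enat_le_Sup_iff[OF ne] using valuation_of_chain_fg[OF I, of n] by blast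
  qed
qed

text \<open>One inclusion is \<open>semistar_mem_of_colon\<close>. For the other, scaling moves
  \<open>x\<close> to 1, and stability allows intersecting with the ring, which leaves the conductor
  of \<open>x\<close> as the required level ideal.\<close>

lemma chain_of_valuation_of_chain: "chain_of_valuation (valuation_of_chain C) = C"
proof (intro ext)
  fix n :: nat and I :: "'a fract set"
  consider "n = 0" | "n > 0" "I \<notin> nz_submodules" | "n > 0" "I \<in> nz_submodules" by auto
  then show "chain_of_valuation (valuation_of_chain C) n I = C n I"
  proof cases
    case 1
    then show ?thesis by (simp add: chain_of_valuation_0 chain_0)
  next
    case 2
    then show ?thesis
      by (simp add: chain_of_valuation_def semistar_extensional[OF chain_semistar])
  next
    case n: 3
    note I = n(2)
    \<comment> \<open>Positivity of n excludes the zero ideal from the level set.\<close>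
    have level: "J \<in> level_ideals (valuation_of_chain C) n \<longleftrightarrow>
        J \<in> ideals \<and> J \<noteq> {0} \<and> 1 \<in> C n (to_fract ` J)" for J
      using n by (auto simp: level_ideals_def le_valuation_of_chain_iff)
    show ?thesis
    proof
      show "chain_of_valuation (valuation_of_chain C) n I \<subseteq> C n I"
      proof
        fix x assume "x \<in> chain_of_valuation (valuation_of_chain C) n I"
        then obtain J where J: "J \<in> level_ideals (valuation_of_chain C) n"
          and x: "x \<in> colon I (to_fract ` J)"
          using I by (auto simp: chain_of_valuation_def)
        then have "to_fract ` J \<in> nz_submodules" "1 \<in> C n (to_fract ` J)"
          using nz_submodule_of_ideal[of J] by (simp_all add: level)
        then show "x \<in> C n I" using x by (rule semistar_mem_of_colon[OF chain_semistar I])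
      qed
      show "C n I \<subseteq> chain_of_valuation (valuation_of_chain C) n I"
      proof
        fix x assume x: "x \<in> C n I"
        show "x \<in> chain_of_valuation (valuation_of_chain C) n I"
        \<comment> \<open>Zero cannot be scaled to 1, but it already belongs to
          \<open>I\<close>.\<close>
        proof (cases "x = 0")
          case True
          then have "x \<in> I" using I by (simp add: nz_submodules_iff)
          then show ?thesis
            using semistar_subset[OF _ I] chain_of_valuation_standard[OF valuation_of_chain_ideal_valuation]
            by (auto simp: standard_chains_def)
        next
          case False
          define I' where "I' = (*) (inverse x) ` I"
          have I': "I' \<in> nz_submodules" using I False by (simp add: I'_def nz_submodule_scale)
          have "1 \<in> (*) (inverse x) ` C n I" using x False by (simp add: mem_scale_iff divide_inverse)
          then have "1 \<in> C n I'"
            using semistar_scale[OF chain_semistar I] False by (simp add: I'_def)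
          \<comment> \<open>Here stability enters: 1 lies in the closures of both \<open>I'\<close>
            and the ring, hence in that of their intersection.\<close>
          then have one: "1 \<in> C n (I' \<inter> range to_fract)"
            using chain_stable[of n] I' semistar_one_mem[OF chain_semistar, of n]
            by (simp add: stable_def range_nz_submodule)
          have "y \<in> I' \<longleftrightarrow> y * x \<in> I" for y
            using False by (simp add: I'_def mem_scale_iff divide_inverse)
          then have "I' \<inter> range to_fract = to_fract ` denominators I x"
            by (auto simp: denominators_def)
          moreover have "I' \<inter> range to_fract \<noteq> {0}"
            using nz_submodule_Int[OF I' range_nz_submodule] by (simp add: nz_submodules_def)
          ultimately have "denominators I x \<in> level_ideals (valuation_of_chain C) n"
            using one denominators_ideal[OF I] by (auto simp: level)
          then show ?thesis
            using I by (auto simp: chain_of_valuation_def mem_colon_iff)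
        qed
      qed
    qed
  qed
qed

end

section \<open>The bijection and its inverse\<close>

theorem theorem2:
  shows "bij_betw chain_of_valuation
           (ideal_valuations :: ('a::idom set \<Rightarrow> enat) set)
           (standard_chains :: (nat \<Rightarrow> 'a fract set \<Rightarrow> 'a fract set) set)
       \<and> (\<forall>C \<in> (standard_chains :: (nat \<Rightarrow> 'a fract set \<Rightarrow> 'a fract set) set).
            inv_into ideal_valuations chain_of_valuation C = valuation_of_chain C)"
proof -
  have bij: "bij_betw chain_of_valuation (ideal_valuations :: ('a set \<Rightarrow> enat) set) standard_chains"
    by (rule bij_betw_byWitness[where f' = valuation_of_chain])
      (auto simp: valuation_of_chain_of_valuation chain_of_valuation_of_chain
        chain_of_valuation_standard valuation_of_chain_ideal_valuation)
  then have "inj_on chain_of_valuation (ideal_valuations :: ('a set \<Rightarrow> enat) set)"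
    by (rule bij_betw_imp_inj_on)
  \<comment> \<open>By injectivity, the preimage chosen by \<open>inv_into\<close> must be the one
    given by \<open>valuation_of_chain\<close>.\<close>
  then show ?thesis
    using bij by (auto intro!: inv_into_f_eq simp: chain_of_valuation_of_chain
        valuation_of_chain_ideal_valuation)
qed

end
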